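(* Let $X$ be a finite set and let $\mathcal{P}(X)$ be the set of partitions of $X$. The function defined on $\mathcal{P}(X)\times\mathcal{P}(X)$ by $$d(p,p')=\frac12\big(\#p+\#p'\big)-\#(p\vee p')$$ is a distance on $\mathcal{P}(X)$.
   Context: A partition of $X$ is a set of nonempty, pairwise disjoint subsets (blocks) of $X$ whose union is $X$. $\#p$ is the number of blocks of $p$. A partition $p$ is finer than $p'$ (and $p'$ is coarser than $p$) if every block of $p$ is contained in a block of $p'$. $p\vee p'$ is the finest partition which is coarser than both $p$ and $p'$. *)

theory Defs
  imports "HOL-Analysis.Abstract_Metric_Spaces" "HOL-Library.Disjoint_Sets"
begin

definition is_partition_join :: "'a set \<Rightarrow> 'a set set \<Rightarrow> 'a set set \<Rightarrow> 'a set set \<Rightarrow> bool"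
  where "is_partition_join X p p' q \<longleftrightarrow>
    refines X p q \<and> refines X p' q \<and>
    (\<forall>r. refines X p r \<and> refines X p' r \<longrightarrow> refines X q r)"

definition partition_join :: "'a set \<Rightarrow> 'a set set \<Rightarrow> 'a set set \<Rightarrow> 'a set set"
  where "partition_join X p p' = (THE q. is_partition_join X p p' q)"

lemma ex1_partition_join:
  assumes p: "partition_on X p" and p': "partition_on X p'"
  shows "\<exists>!q. is_partition_join X p p' q"
proof (rule ex_ex1I)
  let ?U = "{r. refines X p r \<and> refines X p' r}"
  have part: "\<And>r. r \<in> ?U \<Longrightarrow> partition_on X r"
    by (simp add: refines_def)
  have "\<exists>r. refines X p r \<and> refines X p' r"
  proof (cases "X = {}")
    case True
    then show ?thesis
      using p p' refines_refl[OF p] by (metis partition_on_empty)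
  next
    case False
    have "refines X s {X}" if "partition_on X s" for s
      unfolding refines_def using that partition_on_space[OF False] partition_onD1[OF that]
      by blast
    then show ?thesis
      using p p' by blast
  qed
  then have ne: "?U \<noteq> {}"
    by blast
  have up: "refines X s (common_refinement ?U)"
    if "partition_on X s" "\<And>r. r \<in> ?U \<Longrightarrow> refines X s r" for s
    using common_refinement_coarsest[where \<P> = ?U and A = X and R = s] part ne that by metis
  have "refines X p (common_refinement ?U)"
    using p by (rule up) simp
  moreover have "refines X p' (common_refinement ?U)"
    using p' by (rule up) simp
  moreover have "refines X (common_refinement ?U) r" if "r \<in> ?U" for r
    using refines_common_refinement[where \<P> = ?U and A = X and P = r] part that by metis
  ultimately have "is_partition_join X p p' (common_refinement ?U)"
    unfolding is_partition_join_def by blast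
  then show "\<exists>q. is_partition_join X p p' q"
    by blast
next
  fix q q'
  assume q: "is_partition_join X p p' q" and q': "is_partition_join X p p' q'"
  have "refines X q q'" "refines X q' q"
    using q q' by (simp_all add: is_partition_join_def)
  then show "q = q'"
    by (rule refines_asym)
qed

(* The locale Metric_space asks for nonnegativity and symmetry at all arguments of the type,
   so the distance is extended by 0 to arguments that are not partitions of X; this adds no
   content, since the other metric axioms are only required on the carrier. *)
definition partition_dist :: "'a set \<Rightarrow> 'a set set \<Rightarrow> 'a set set \<Rightarrow> real"
  where "partition_dist X p p' =
    (if partition_on X p \<and> partition_on X p'
     then 1 / 2 * (real (card p) + real (card p')) - real (card (partition_join X p p'))
     else 0)"

end

(* Coarsening p one merge of two blocks at a time lowers the number of blocks of p by one and
   that of the join of p with a fixed r by at most one. Hence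
   #(p v r) + #q <= #(q v r) + #p whenever q is coarser than p. Taking p = p', q = p v p',
   r = p'' gives #(p v p') + #(p' v p'') <= #p' + #(p v p' v p''), and the last term is at most
   #p' + #(p v p''): this is the triangle inequality. *)
theory Submission
  imports Defs
begin

section \<open>Refinement and the number of blocks\<close>

lemma refines_partition_on:
  assumes "refines X p q"
  shows "partition_on X p" "partition_on X q"
  using assms by (auto simp: refines_def)

lemma partition_on_block_unique:
  assumes "partition_on X p" "B \<in> p" "C \<in> p" "x \<in> B" "x \<in> C"
  shows "B = C"
  using assms by (auto simp: partition_on_def disjoint_def)

lemma refines_block_subset:
  assumes "refines X p q" "B \<in> p" "A \<in> q" "x \<in> B" "x \<in> A"
  shows "B \<subseteq> A"
proof -
  obtain A' where "A' \<in> q" "B \<subseteq> A'"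
    using assms by (auto simp: refines_def)
  then show ?thesis
    using partition_on_block_unique[of X q A A' x] assms refines_partition_on by blast
qed

text \<open>Sending each block of \<open>p\<close> to a block of \<open>q\<close> that contains it
  is onto \<open>q\<close>: a block \<open>A\<close> of \<open>q\<close> has a point, and the block
  of \<open>p\<close> through that point can only be sent to \<open>A\<close>.\<close>

lemma refines_card_le:
  assumes "finite X" "refines X p q"
  shows "card q \<le> card p"
proof -
  have "\<forall>B\<in>p. \<exists>A. A \<in> q \<and> B \<subseteq> A"
    using assms(2) by (auto simp: refines_def)
  then obtain f where f: "\<forall>B\<in>p. f B \<in> q \<and> B \<subseteq> f B"
    by (rule bchoice[THEN exE])
  have "q \<subseteq> f ` p"
  proof
    fix A assume A: "A \<in> q"
    then obtain x where x: "x \<in> A"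
      using refines_partition_on(2)[OF assms(2)] by (metis ex_in_conv partition_onD3)
    then obtain B where B: "B \<in> p" "x \<in> B"
      using A refines_partition_on[OF assms(2)] by (metis Union_iff partition_onD1)
    then have "f B = A"
      using partition_on_block_unique[of X q "f B" A x] f A x refines_partition_on(2)[OF assms(2)]
      by blast
    then show "A \<in> f ` p"
      using B by blast
  qed
  moreover have "finite p"
    using finite_elements assms(1) refines_partition_on(1)[OF assms(2)] by blast
  ultimately show ?thesis
    by (rule surj_card_le[rotated])
qed

text \<open>Supplies two blocks of \<open>p\<close> whose merging stays finer than \<open>q\<close>.
  By antisymmetry some block \<open>A\<close> of \<open>q\<close> lies in no block of
  \<open>p\<close>, so the points of \<open>A\<close> are spread over at least two blocks of
  \<open>p\<close>.\<close>

lemma refines_neq_obtain_blocks: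
  assumes "refines X p q" "p \<noteq> q"
  obtains A B C where "A \<in> q" "B \<in> p" "C \<in> p" "B \<noteq> C" "B \<subseteq> A" "C \<subseteq> A"
proof -
  note parts = refines_partition_on[OF assms(1)]
  have "\<not> refines X q p"
    using assms refines_asym by blast
  then obtain A where A: "A \<in> q" "\<And>B. B \<in> p \<Longrightarrow> \<not> A \<subseteq> B"
    using parts by (auto simp: refines_def)
  have cover: "\<exists>B\<in>p. x \<in> B" if "x \<in> A" for x
    using that A(1) parts by (metis Union_iff partition_onD1)
  obtain x where x: "x \<in> A"
    using A(1) parts(2) by (metis ex_in_conv partition_onD3)
  obtain B where B: "B \<in> p" "x \<in> B"
    using cover[OF x] by blast
  obtain y where y: "y \<in> A" "y \<notin> B"
    using A(2)[OF B(1)] by blast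
  obtain C where C: "C \<in> p" "y \<in> C"
    using cover[OF y(1)] by blast
  show thesis
    using that[of A B C] A(1) B C x y refines_block_subset[OF assms(1)] by blast
qed

section \<open>Merging two blocks\<close>

definition merge_blocks :: "'a set set \<Rightarrow> 'a set \<Rightarrow> 'a set \<Rightarrow> 'a set set"
  where "merge_blocks p B C = insert (B \<union> C) (p - {B, C})"

text \<open>This degenerate case lets \<open>merge_blocks_mono\<close> cover blocks of
  \<open>p\<close> that lie in one and the same block of \<open>q\<close>.\<close>

lemma merge_blocks_same: "B \<in> p \<Longrightarrow> merge_blocks p B B = p"
  by (auto simp: merge_blocks_def)

lemma partition_on_merge_blocks:
  assumes "partition_on X p" "B \<in> p" "C \<in> p"
  shows "partition_on X (merge_blocks p B C)"
proof (rule partition_onI)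
  show "\<Union> (merge_blocks p B C) = X"
    using assms partition_onD1[OF assms(1)] by (auto simp: merge_blocks_def)
  show "{} \<notin> merge_blocks p B C"
    using assms by (auto simp: merge_blocks_def partition_on_def)
  show "disjnt D E" if "D \<in> merge_blocks p B C" "E \<in> merge_blocks p B C" "D \<noteq> E" for D E
    using that partition_on_block_unique[OF assms(1)] assms(2,3)
    by (auto simp: merge_blocks_def disjnt_iff)
qed

lemma refines_merge_blocks:
  assumes "partition_on X p" "B \<in> p" "C \<in> p"
  shows "refines X p (merge_blocks p B C)"
  using assms partition_on_merge_blocks[OF assms] by (auto simp: refines_def merge_blocks_def)

text \<open>A block other than \<open>B \<union> C\<close> is an old block of \<open>p\<close>; it
  lies in a block of \<open>q\<close>, which in turn lies in a block of the merged
  \<open>q\<close>.\<close>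

lemma merge_blocks_mono:
  assumes "refines X p q" "B \<in> p" "C \<in> p" "D \<in> q" "E \<in> q" "B \<subseteq> D" "C \<subseteq> E"
  shows "refines X (merge_blocks p B C) (merge_blocks q D E)"
proof -
  note parts = refines_partition_on[OF assms(1)]
  have "\<exists>A\<in>merge_blocks q D E. F \<subseteq> A" if "F \<in> merge_blocks p B C" for F
  proof (cases "F = B \<union> C")
    case True
    then show ?thesis
      using assms by (auto simp: merge_blocks_def)
  next
    case False
    then have "F \<in> p"
      using that by (simp add: merge_blocks_def)
    then obtain A where A: "A \<in> q" "F \<subseteq> A"
      using assms(1) by (auto simp: refines_def)
    moreover obtain A' where "A' \<in> merge_blocks q D E" "A \<subseteq> A'"
      using refines_merge_blocks[OF parts(2) assms(4,5)] A(1) by (auto simp: refines_def)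
    ultimately show ?thesis
      by blast
  qed
  then show ?thesis
    using partition_on_merge_blocks parts assms(2-5) by (auto simp: refines_def)
qed

lemma card_merge_blocks:
  assumes "finite X" "partition_on X p" "B \<in> p" "C \<in> p" "B \<noteq> C"
  shows "Suc (card (merge_blocks p B C)) = card p"
proof -
  have fin: "finite p"
    using finite_elements assms(1,2) by blast
  have "B \<noteq> {}"
    using assms by (auto simp: partition_on_def)
  then obtain x where "x \<in> B"
    by blast
  \<comment> \<open>If the union were in \<open>p\<close>, it would share \<open>x\<close> with
    \<open>B\<close> and so be equal to \<open>B\<close>. Hence the insertion really adds a
    block.\<close>
  then have "B \<union> C \<notin> p - {B, C}"
    using partition_on_block_unique[OF assms(2,3)] by blast
  then have "card (merge_blocks p B C) = Suc (card (p - {B, C}))"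
    using fin by (simp add: merge_blocks_def)
  moreover have "card (p - {B, C}) = card p - 2"
    using assms fin by (simp add: card_Diff_subset)
  moreover have "2 \<le> card p"
    using card_mono[OF fin, of "{B, C}"] assms by simp
  ultimately show ?thesis
    by linarith
qed

text \<open>Otherwise two blocks of \<open>p\<close> inside one block of \<open>q\<close> could be
  merged, giving a refinement of \<open>q\<close> with fewer blocks than \<open>q\<close>.\<close>

lemma refines_card_eq:
  assumes "finite X" "refines X p q" "card p = card q"
  shows "p = q"
proof (rule ccontr)
  assume "p \<noteq> q"
  then obtain A B C where b: "A \<in> q" "B \<in> p" "C \<in> p" "B \<noteq> C" "B \<subseteq> A" "C \<subseteq> A"
    using refines_neq_obtain_blocks assms(2) by metis
  then have "refines X (merge_blocks p B C) q"
    using merge_blocks_mono[OF assms(2) b(2,3,1,1)] by (simp add: merge_blocks_same)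
  then show False
    using refines_card_le[OF assms(1)] card_merge_blocks[OF assms(1) _ b(2-4)] assms(2,3)
    by (metis Suc_n_not_le_n refines_partition_on(1))
qed

section \<open>Joins and the number of their blocks\<close>

lemma is_partition_join_partition_join:
  assumes "partition_on X p" "partition_on X q"
  shows "is_partition_join X p q (partition_join X p q)"
  unfolding partition_join_def by (rule theI'[OF ex1_partition_join[OF assms]])

lemma
  assumes "partition_on X p" "partition_on X q"
  shows refines_partition_join1: "refines X p (partition_join X p q)"
    and refines_partition_join2: "refines X q (partition_join X p q)"
    and partition_join_least:
      "\<And>r. refines X p r \<Longrightarrow> refines X q r \<Longrightarrow> refines X (partition_join X p q) r"
  using is_partition_join_partition_join[OF assms] by (auto simp: is_partition_join_def)

lemma partition_on_partition_join:
  assumes "partition_on X p" "partition_on X q"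
  shows "partition_on X (partition_join X p q)"
  using refines_partition_join1[OF assms] refines_partition_on(2) by blast

lemma partition_join_commute: "partition_join X p q = partition_join X q p"
proof -
  have "is_partition_join X p q = is_partition_join X q p"
    by (auto simp: is_partition_join_def)
  then show ?thesis
    by (simp add: partition_join_def)
qed

lemma partition_join_same:
  assumes "partition_on X p"
  shows "partition_join X p p = p"
  using assms partition_join_least refines_partition_join1 refines_refl refines_asym by metis

text \<open>Merging the blocks \<open>D\<close> and \<open>E\<close> of the join that contain
  \<open>B\<close> and \<open>C\<close> gives a partition coarser than both the merged
  \<open>p\<close> and \<open>r\<close>, hence coarser than their join. This costs the old join at
  most one block.\<close>

lemma card_partition_join_merge_blocks:
  assumes "finite X" and p: "partition_on X p" and r: "partition_on X r"
    and B: "B \<in> p" and C: "C \<in> p"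
  shows "card (partition_join X p r) \<le> Suc (card (partition_join X (merge_blocks p B C) r))"
proof -
  let ?j = "partition_join X p r"
  have j: "partition_on X ?j" and pj: "refines X p ?j" and rj: "refines X r ?j"
    using partition_on_partition_join refines_partition_join1 refines_partition_join2 p r by blast+
  obtain D E where D: "D \<in> ?j" "B \<subseteq> D" and E: "E \<in> ?j" "C \<subseteq> E"
    using pj B C unfolding refines_def by meson
  have "refines X (partition_join X (merge_blocks p B C) r) (merge_blocks ?j D E)"
  proof (rule partition_join_least)
    show "refines X (merge_blocks p B C) (merge_blocks ?j D E)"
      using merge_blocks_mono pj B C D E by blast
    show "refines X r (merge_blocks ?j D E)"
      using refines_trans rj refines_merge_blocks j D E by blast
  qed (use p r B C partition_on_merge_blocks in blast)+
  then have "card (merge_blocks ?j D E) \<le> card (partition_join X (merge_blocks p B C) r)"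
    using refines_card_le assms(1) by blast
  moreover have "card ?j \<le> Suc (card (merge_blocks ?j D E))"
  proof (cases "D = E")
    case True
    then show ?thesis
      using D by (simp add: merge_blocks_same)
  next
    case False
    then show ?thesis
      using card_merge_blocks[OF assms(1) j] D E by simp
  qed
  ultimately show ?thesis
    by linarith
qed

text \<open>Passing from \<open>p\<close> to the coarser \<open>q\<close> loses at least as many
  blocks as passing from the join of \<open>p\<close> with \<open>r\<close> to that of
  \<open>q\<close> with \<open>r\<close>. The additive form avoids truncated subtraction on the
  naturals.\<close>

lemma card_partition_join_refines:
  assumes "finite X" "refines X p q" "partition_on X r"
  shows "card (partition_join X p r) + card q \<le> card (partition_join X q r) + card p"
  using assms(2)
proof (induction "card p" arbitrary: p rule: less_induct)
  case less
  show ?case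
  proof (cases "p = q")
    case False
    then obtain A B C where b: "A \<in> q" "B \<in> p" "C \<in> p" "B \<noteq> C" "B \<subseteq> A" "C \<subseteq> A"
      using refines_neq_obtain_blocks less.prems by metis
    have p: "partition_on X p"
      using less.prems refines_partition_on by blast
    \<comment> \<open>Both blocks lie in \<open>A\<close>, and merging \<open>A\<close> with itself
      leaves \<open>q\<close> unchanged, so the induction hypothesis applies to the merged
      partition.\<close>
    have "refines X (merge_blocks p B C) q"
      using merge_blocks_mono[OF less.prems b(2,3,1,1)] b by (simp add: merge_blocks_same)
    moreover have c: "Suc (card (merge_blocks p B C)) = card p"
      using card_merge_blocks assms(1) p b by blast
    ultimately have "card (partition_join X (merge_blocks p B C) r) + card q
        \<le> card (partition_join X q r) + card (merge_blocks p B C)"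
      using less.hyps by simp
    then show ?thesis
      using c card_partition_join_merge_blocks[OF assms(1) p assms(3) b(2,3)] by linarith
  qed simp
qed

text \<open>This is the triangle inequality after cancelling the halves of \<open>card p\<close> and
  \<open>card r\<close>; the two halves of \<open>card q\<close> add up.\<close>

lemma card_partition_join_triangle:
  assumes "finite X" and p: "partition_on X p" and q: "partition_on X q" and r: "partition_on X r"
  shows "card (partition_join X p q) + card (partition_join X q r)
    \<le> card q + card (partition_join X p r)"
proof -
  let ?j = "partition_join X p q"
  note j = partition_on_partition_join[OF p q]
  \<comment> \<open>The right-hand side is the join of all three partitions.\<close>
  have "refines X (partition_join X p r) (partition_join X ?j r)"
  proof (rule partition_join_least[OF p r])
    show "refines X p (partition_join X ?j r)"
      by (rule refines_trans[OF refines_partition_join1[OF p q] refines_partition_join1[OF j r]])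
    show "refines X r (partition_join X ?j r)"
      by (rule refines_partition_join2[OF j r])
  qed
  then have "card (partition_join X ?j r) \<le> card (partition_join X p r)"
    using refines_card_le assms(1) by blast
  moreover have "card (partition_join X q r) + card ?j \<le> card (partition_join X ?j r) + card q"
    using card_partition_join_refines assms(1) refines_partition_join2[OF p q] r by blast
  ultimately show ?thesis
    by linarith
qed

theorem mainTheorem1:
  fixes X :: "'a set"
  assumes "finite X"
  shows "Metric_space {p. partition_on X p} (partition_dist X)"
proof
  have le: "card (partition_join X p q) \<le> card p" "card (partition_join X p q) \<le> card q"
    if "partition_on X p" "partition_on X q" for p q
    using refines_card_le[OF assms refines_partition_join1[OF that]]
      refines_card_le[OF assms refines_partition_join2[OF that]] by auto
  \<comment> \<open>The distance is half the sum of the two differences bounded by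
    \<open>le\<close>; outside the partitions of \<open>X\<close> it is 0 by definition.\<close>
  show "0 \<le> partition_dist X p q" for p q
    using le[of p q] by (auto simp: partition_dist_def)
  show "partition_dist X p q = partition_dist X q p" for p q
    by (simp add: partition_dist_def partition_join_commute[of X p q])
  show "partition_dist X p q = 0 \<longleftrightarrow> p = q"
    if "p \<in> {p. partition_on X p}" "q \<in> {p. partition_on X p}" for p q
  proof
    have pq: "partition_on X p" "partition_on X q"
      using that by auto
    assume "partition_dist X p q = 0"
    \<comment> \<open>Two nonnegative differences with sum 0 both vanish.\<close>
    then have "card (partition_join X p q) = card p" "card (partition_join X p q) = card q"
      using pq le[of p q] by (auto simp: partition_dist_def)
    then have "p = partition_join X p q" "q = partition_join X p q"
      using refines_card_eq[OF assms refines_partition_join1[OF pq]]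
        refines_card_eq[OF assms refines_partition_join2[OF pq]] by argo+
    then show "p = q"
      by (rule trans[OF _ sym])
  qed (use that in \<open>simp add: partition_dist_def partition_join_same\<close>)
  show "partition_dist X p r \<le> partition_dist X p q + partition_dist X q r"
    if "p \<in> {p. partition_on X p}" "q \<in> {p. partition_on X p}" "r \<in> {p. partition_on X p}"
    for p q r
    using that card_partition_join_triangle[OF assms, of p q r]
    by (simp add: partition_dist_def field_simps)
qed

end
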